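(* Let $(X,\mathbb{F})$ and $(Y,\mathbb{G})$ be non-autonomous dynamical systems generated by $\mathbb{F}=\{f_n:n\in\mathbb{N}\}$ and $\mathbb{G}=\{g_n:n\in\mathbb{N}\}$ respectively. If $(g_n)$ converges uniformly to a map $g$, then for all $x_1,x_2\in X$ and $y_1,y_2\in Y$: $((x_1,x_2),(y_1,y_2))\in L(X,\mathbb{F})\times P(Y,\mathbb{G})$ implies $((x_1,y_1),(x_2,y_2))\in P(X\times Y,\mathbb{F}\times\mathbb{G})$.
   Context: A non-autonomous system $(X,\mathbb{F})$ consists of a compact metric space $(X,d_X)$ and a sequence $\mathbb{F}=(f_n)_{n\ge 1}$ of surjective continuous self-maps of $X$; $\omega_n=f_n\circ\cdots\circ f_1$. The product system $(X\times Y,\mathbb{F}\times\mathbb{G})$ is generated by the maps $f_n\times g_n$ on $X\times Y$ with the product (e.g. maximum) metric. A set $S=\{s_n:n\in\mathbb{N}\}\subseteq\mathbb{N}$ (with $s_1<s_2<\cdots$) is syndetic if there is $M\in\mathbb{N}$ with $|s_{n+1}-s_n|\le M$ for all $n$. For any non-autonomous system $(X,\mathbb{F})$: $P(X,\mathbb{F})$ is the set of proximal pairs, i.e. pairs $(x,y)\in X\times X$ with $\liminf_n d_X(\omega_n(x),\omega_n(y))=0$; $L(X,\mathbb{F})$ is the set of syndetically proximal pairs, i.e. pairs $(x,y)$ such that for every $\epsilon>0$ the set $\{n\in\mathbb{N}: d_X(\omega_n(x),\omega_n(y))<\epsilon\}$ is syndetic. *)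

theory Defs
  imports "HOL-Analysis.Analysis"
begin

text \<open>The maps are indexed by \<open>n \<ge> 1\<close>; the value \<open>f 0\<close> of the sequence is never used.
  Continuity includes that \<open>f n\<close> maps the carrier into itself.\<close>

locale nonautonomous_system = Metric_space X d
  for X :: "'a set" and d :: "'a \<Rightarrow> 'a \<Rightarrow> real" +
  fixes f :: "nat \<Rightarrow> 'a \<Rightarrow> 'a"
  assumes compact: "compact_space mtopology"
    and continuous: "\<And>n. n \<ge> 1 \<Longrightarrow> continuous_map mtopology mtopology (f n)"
    and surjective: "\<And>n. n \<ge> 1 \<Longrightarrow> f n ` X = X"

primrec iter :: "(nat \<Rightarrow> 'a \<Rightarrow> 'a) \<Rightarrow> nat \<Rightarrow> 'a \<Rightarrow> 'a" where
  "iter f 0 = id"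
| "iter f (Suc n) = f (Suc n) \<circ> iter f n"

definition syndetic :: "nat set \<Rightarrow> bool" where
  "syndetic S \<longleftrightarrow>
     (\<exists>s. strict_mono s \<and> S = range s \<and> (\<exists>M. \<forall>n. s (Suc n) - s n \<le> M))"

definition proximal_pairs ::
    "'a set \<Rightarrow> ('a \<Rightarrow> 'a \<Rightarrow> real) \<Rightarrow> (nat \<Rightarrow> 'a \<Rightarrow> 'a) \<Rightarrow> ('a \<times> 'a) set" where
  "proximal_pairs X d f =
     {(x, y) \<in> X \<times> X. liminf (\<lambda>n. ereal (d (iter f n x) (iter f n y))) = 0}"

definition syndetically_proximal_pairs ::
    "'a set \<Rightarrow> ('a \<Rightarrow> 'a \<Rightarrow> real) \<Rightarrow> (nat \<Rightarrow> 'a \<Rightarrow> 'a) \<Rightarrow> ('a \<times> 'a) set" where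
  "syndetically_proximal_pairs X d f =
     {(x, y) \<in> X \<times> X. \<forall>\<epsilon>>0. syndetic {n. n \<ge> 1 \<and> d (iter f n x) (iter f n y) < \<epsilon>}}"

definition converges_uniformly_on ::
    "'a set \<Rightarrow> ('a \<Rightarrow> 'a \<Rightarrow> real) \<Rightarrow> (nat \<Rightarrow> 'a \<Rightarrow> 'a) \<Rightarrow> ('a \<Rightarrow> 'a) \<Rightarrow> bool" where
  "converges_uniformly_on X d f h \<longleftrightarrow>
     h \<in> X \<rightarrow> X \<and> (\<forall>\<epsilon>>0. \<forall>\<^sub>F n in sequentially. \<forall>x\<in>X. d (f n x) (h x) < \<epsilon>)"

text \<open>The library's \<^const>\<open>prod_dist\<close> is the Euclidean product metric; this is the maximum metric.\<close>

definition max_dist ::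
    "('a \<Rightarrow> 'a \<Rightarrow> real) \<Rightarrow> ('b \<Rightarrow> 'b \<Rightarrow> real) \<Rightarrow> 'a \<times> 'b \<Rightarrow> 'a \<times> 'b \<Rightarrow> real" where
  "max_dist d1 d2 p q = max (d1 (fst p) (fst q)) (d2 (snd p) (snd q))"

definition prod_maps ::
    "(nat \<Rightarrow> 'a \<Rightarrow> 'a) \<Rightarrow> (nat \<Rightarrow> 'b \<Rightarrow> 'b) \<Rightarrow> nat \<Rightarrow> 'a \<times> 'b \<Rightarrow> 'a \<times> 'b" where
  "prod_maps f g n = map_prod (f n) (g n)"

lemma Metric_space_max_dist:
  assumes "Metric_space X dX" and "Metric_space Y dY"
  shows "Metric_space (X \<times> Y) (max_dist dX dY)"
proof -
  interpret X: Metric_space X dX by fact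
  interpret Y: Metric_space Y dY by fact
  show ?thesis
  proof
    fix p q r
    show "0 \<le> max_dist dX dY p q"
      by (simp add: max_dist_def le_max_iff_disj)
    show "max_dist dX dY p q = max_dist dX dY q p"
      by (simp add: max_dist_def X.commute Y.commute)
    assume p: "p \<in> X \<times> Y" and q: "q \<in> X \<times> Y"
    have nn: "0 \<le> dX (fst p) (fst q)" "0 \<le> dY (snd p) (snd q)" by auto
    show "max_dist dX dY p q = 0 \<longleftrightarrow> p = q"
    proof
      assume "max_dist dX dY p q = 0"
      then have "dX (fst p) (fst q) = 0" "dY (snd p) (snd q) = 0"
        using nn unfolding max_dist_def by linarith+
      then show "p = q"
        using p q by (auto simp: prod_eq_iff mem_Times_iff)
    next
      assume "p = q"
      then show "max_dist dX dY p q = 0"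
        using p by (auto simp: max_dist_def)
    qed
    assume r: "r \<in> X \<times> Y"
    have "dX (fst p) (fst r) \<le> dX (fst p) (fst q) + dX (fst q) (fst r)"
      "dY (snd p) (snd r) \<le> dY (snd p) (snd q) + dY (snd q) (snd r)"
      using p q r by (auto intro: X.triangle Y.triangle)
    then show "max_dist dX dY p r \<le> max_dist dX dY p q + max_dist dX dY q r"
      unfolding max_dist_def by linarith
  qed
qed

lemma mtopology_max_dist:
  assumes "Metric_space X dX" and "Metric_space Y dY"
  shows "Metric_space.mtopology (X \<times> Y) (max_dist dX dY) =
    prod_topology (Metric_space.mtopology X dX) (Metric_space.mtopology Y dY)"
proof -
  interpret X: Metric_space X dX by fact
  interpret Y: Metric_space Y dY by fact
  interpret XY: Metric_space "X \<times> Y" "max_dist dX dY"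
    using assms by (rule Metric_space_max_dist)
  have ball: "XY.mball (x, y) r = X.mball x r \<times> Y.mball y r" for x y r
    by (auto simp: max_dist_def)
  show ?thesis
  proof (rule topology_eq[THEN iffD2], intro allI iffI)
    fix S
    assume S: "openin XY.mtopology S"
    show "openin (prod_topology X.mtopology Y.mtopology) S"
      unfolding openin_prod_topology_alt
    proof (intro allI impI)
      fix x y
      assume xy: "(x, y) \<in> S"
      then obtain r where r: "r > 0" "XY.mball (x, y) r \<subseteq> S"
        using S unfolding XY.openin_mtopology by blast
      have "x \<in> X" "y \<in> Y"
        using S xy unfolding XY.openin_mtopology by auto
      then show "\<exists>U V. openin X.mtopology U \<and> openin Y.mtopology V \<and> x \<in> U \<and> y \<in> V \<and> U \<times> V \<subseteq> S"
        using r ball by (metis X.openin_mball Y.openin_mball X.centre_in_mball_iff Y.centre_in_mball_iff)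
    qed
  next
    fix S
    assume S: "openin (prod_topology X.mtopology Y.mtopology) S"
    show "openin XY.mtopology S"
      unfolding XY.openin_mtopology
    proof (intro conjI allI impI)
      show "S \<subseteq> X \<times> Y"
        using openin_subset[OF S] by simp
      fix p
      assume "p \<in> S"
      then obtain U V where UV: "openin X.mtopology U" "openin Y.mtopology V"
        "fst p \<in> U" "snd p \<in> V" "U \<times> V \<subseteq> S"
        using S unfolding openin_prod_topology_alt by (metis prod.collapse)
      obtain r where r: "r > 0" "X.mball (fst p) r \<subseteq> U"
        using UV unfolding X.openin_mtopology by blast
      obtain s where s: "s > 0" "Y.mball (snd p) s \<subseteq> V"
        using UV unfolding Y.openin_mtopology by blast
      have "XY.mball p (min r s) \<subseteq> X.mball (fst p) r \<times> Y.mball (snd p) s"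
        by (auto simp: max_dist_def)
      also have "\<dots> \<subseteq> S"
        using r s UV by blast
      finally show "\<exists>r>0. XY.mball p r \<subseteq> S"
        using r s by (intro exI[of _ "min r s"]) simp
    qed
  qed
qed

lemma nonautonomous_system_prod:
  assumes "nonautonomous_system X dX f" and "nonautonomous_system Y dY g"
  shows "nonautonomous_system (X \<times> Y) (max_dist dX dY) (prod_maps f g)"
proof -
  interpret X: nonautonomous_system X dX f by fact
  interpret Y: nonautonomous_system Y dY g by fact
  have top: "Metric_space.mtopology (X \<times> Y) (max_dist dX dY) = prod_topology X.mtopology Y.mtopology"
    by (intro mtopology_max_dist X.Metric_space_axioms Y.Metric_space_axioms)
  interpret XY: Metric_space "X \<times> Y" "max_dist dX dY"
    by (intro Metric_space_max_dist X.Metric_space_axioms Y.Metric_space_axioms)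
  show ?thesis
  proof
    show "compact_space XY.mtopology"
      using X.compact Y.compact by (simp add: top compact_space_prod_topology)
    fix n :: nat
    assume "n \<ge> 1"
    then show "continuous_map XY.mtopology XY.mtopology (prod_maps f g n)"
      using X.continuous Y.continuous
      by (simp add: top prod_maps_def map_prod_def continuous_map_prod_top)
    show "prod_maps f g n ` (X \<times> Y) = X \<times> Y"
      using X.surjective[OF \<open>n \<ge> 1\<close>] Y.surjective[OF \<open>n \<ge> 1\<close>]
      by (simp add: prod_maps_def map_prod_surj_on)
  qed
qed

end

theory Submission
  imports Defs
begin

text \<open>Since \<open>g\<^sub>n\<close> converges uniformly, the tail of \<open>(g\<^sub>n)\<close> is uniformly equicontinuous, and hence so are
  all blocks of at most \<open>M\<close> consecutive maps of that tail. Fix \<open>\<epsilon> > 0\<close> and let \<open>M\<close> bound the gaps of the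
  times at which the orbits of \<open>x\<^sub>1\<close>, \<open>x\<^sub>2\<close> are \<open>\<epsilon>\<close>-close. At arbitrarily late times \<open>n\<close> the orbits of
  \<open>y\<^sub>1\<close>, \<open>y\<^sub>2\<close> are so close that they stay \<open>\<epsilon>\<close>-close during the next \<open>M\<close> steps, and one of
  these steps is a time at which the orbits of \<open>x\<^sub>1\<close>, \<open>x\<^sub>2\<close> are \<open>\<epsilon>\<close>-close as well.\<close>

text \<open>Turns proximality into arbitrarily late close times, the form in which it is both used
  and proved below. Nonnegativity bounds the liminf below by 0.\<close>

lemma liminf_ereal_eq_0_iff:
  fixes u :: "nat \<Rightarrow> real"
  assumes nonneg: "\<And>n. 0 \<le> u n"
  shows "liminf (\<lambda>n. ereal (u n)) = 0 \<longleftrightarrow> (\<forall>\<epsilon>>0. \<forall>N. \<exists>n\<ge>N. u n < \<epsilon>)"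
proof
  assume lim: "liminf (\<lambda>n. ereal (u n)) = 0"
  show "\<forall>\<epsilon>>0. \<forall>N. \<exists>n\<ge>N. u n < \<epsilon>"
  proof (intro allI impI, rule ccontr)
    fix \<epsilon> :: real and N
    assume "\<epsilon> > 0" and "\<not> (\<exists>n\<ge>N. u n < \<epsilon>)"
    then have "\<forall>\<^sub>F n in sequentially. ereal \<epsilon> \<le> ereal (u n)"
      unfolding eventually_sequentially by (metis ereal_less_eq(3) not_less)
    then have "ereal \<epsilon> \<le> liminf (\<lambda>n. ereal (u n))"
      by (rule Liminf_bounded)
    with lim \<open>\<epsilon> > 0\<close> show False
      by simp
  qed
next
  assume small: "\<forall>\<epsilon>>0. \<forall>N. \<exists>n\<ge>N. u n < \<epsilon>"
  have "0 \<le> liminf (\<lambda>n. ereal (u n))"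
    by (rule Liminf_bounded) (simp add: nonneg)
  moreover have "\<not> 0 < liminf (\<lambda>n. ereal (u n))"
  proof
    assume "0 < liminf (\<lambda>n. ereal (u n))"
    then obtain c where c: "0 < ereal c" "ereal c < liminf (\<lambda>n. ereal (u n))"
      by (metis ereal_dense2)
    from less_LiminfD[OF c(2)] obtain N where "\<forall>n\<ge>N. c < u n"
      by (auto simp: eventually_sequentially)
    moreover have "\<exists>n\<ge>N. u n < c"
      using small c(1) by simp
    ultimately show False
      by force
  qed
  ultimately show "liminf (\<lambda>n. ereal (u n)) = 0"
    by simp
qed

text \<open>Gaps are bounded only between successive elements of \<open>S\<close>, so
  \<open>N\<close> is taken to be the first element \<open>s 0\<close>.\<close>

lemma syndetic_bounded_gaps:
  assumes "syndetic S"
  obtains M N where "\<And>n. n \<ge> N \<Longrightarrow> \<exists>k\<le>M. n + k \<in> S"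
proof -
  obtain s M where s: "strict_mono s" "S = range s" and M: "\<And>n. s (Suc n) - s n \<le> M"
    using assms unfolding syndetic_def by blast
  have "\<exists>k\<le>M. n + k \<in> S" if n: "n \<ge> s 0" for n
  proof -
    \<comment> \<open>The first element at or after \<open>n\<close>: either it is
      \<open>s 0\<close>, or its predecessor lies below \<open>n\<close> and the gap bound keeps it
      within \<open>n + M\<close>.\<close>
    define i where "i = (LEAST i. n \<le> s i)"
    have i: "n \<le> s i"
      unfolding i_def by (rule LeastI[of _ n]) (rule strict_mono_imp_increasing[OF s(1)])
    have "s i \<le> n + M"
    proof (cases i)
      case 0
      then show ?thesis using n by simp
    next
      case (Suc j)
      then have "s j < n"
        using not_less_Least[of j "\<lambda>i. n \<le> s i"] unfolding i_def by simp
      then show ?thesis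
        using M[of j] Suc by simp
    qed
    with i s(2) show ?thesis
      by (intro exI[of _ "s i - n"]) auto
  qed
  then show thesis
    by (rule that)
qed

lemma iter_prod_maps: "iter (prod_maps f g) n = map_prod (iter f n) (iter g n)"
  by (induction n) (auto simp: prod_maps_def fun_eq_iff)

context nonautonomous_system
begin

lemma iter_in_space: "x \<in> X \<Longrightarrow> iter f n x \<in> X"
  using surjective by (induction n) auto

text \<open>Heine-Cantor for a single map; \<open>\<delta>\<close> may depend on
  \<open>n\<close>.\<close>

lemma uniformly_continuous:
  assumes "n \<ge> 1" and "\<epsilon> > 0"
  obtains \<delta> where "\<delta> > 0" "\<And>x y. \<lbrakk>x \<in> X; y \<in> X; d x y < \<delta>\<rbrakk> \<Longrightarrow> d (f n x) (f n y) < \<epsilon>"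
proof -
  have "uniformly_continuous_map (metric (X, d)) (metric (X, d)) (f n)"
    by (rule continuous_imp_uniformly_continuous_map)
      (simp add: mtopology_of_def compact continuous[OF assms(1)])
  then have "\<exists>\<delta>>0. \<forall>x\<in>X. \<forall>y\<in>X. d y x < \<delta> \<longrightarrow> d (f n y) (f n x) < \<epsilon>"
    using assms(2) by (simp add: uniformly_continuous_map_def)
  then show thesis
    using that by blast
qed

text \<open>All maps of the tail are uniformly close to one of them, \<open>f N\<close>, by passing
  through \<open>h\<close>. Hence a modulus of continuity of \<open>f N\<close> serves for the whole
  tail.\<close>

lemma uniform_limit_imp_tail_equicontinuous:
  assumes lim: "converges_uniformly_on X d f h" and "\<epsilon> > 0"
  obtains \<delta> N where "\<delta> > 0"
    "\<And>n x y. \<lbrakk>n \<ge> N; x \<in> X; y \<in> X; d x y < \<delta>\<rbrakk> \<Longrightarrow> d (f n x) (f n y) < \<epsilon>"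
proof -
  have h: "h x \<in> X" if "x \<in> X" for x
    using lim that unfolding converges_uniformly_on_def by blast
  \<comment> \<open>Five shares: two for passing from \<open>f n\<close> to \<open>f N\<close>
    through \<open>h\<close> at \<open>x\<close>, two for the same at \<open>y\<close>, and one for
    the modulus of \<open>f N\<close>.\<close>
  have "\<forall>\<^sub>F n in sequentially. \<forall>x\<in>X. d (f n x) (h x) < \<epsilon> / 5"
    using lim divide_pos_pos[OF \<open>\<epsilon> > 0\<close>, of 5, OF zero_less_numeral] unfolding converges_uniformly_on_def by fast
  then obtain N0 where N0: "\<And>n x. \<lbrakk>n \<ge> N0; x \<in> X\<rbrakk> \<Longrightarrow> d (f n x) (h x) < \<epsilon> / 5"
    unfolding eventually_sequentially by blast
  \<comment> \<open>The index 0 is excluded because nothing is assumed about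
    \<open>f 0\<close>.\<close>
  define N where "N = max 1 N0"
  have N: "d (f n x) (h x) < \<epsilon> / 5" if "n \<ge> N" "x \<in> X" for n x
    using N0 that by (simp add: N_def)
  obtain \<delta> where "\<delta> > 0"
    and \<delta>: "\<And>x y. \<lbrakk>x \<in> X; y \<in> X; d x y < \<delta>\<rbrakk> \<Longrightarrow> d (f N x) (f N y) < \<epsilon> / 5"
    using uniformly_continuous[of N "\<epsilon> / 5"] \<open>\<epsilon> > 0\<close> by (auto simp: N_def)
  have f: "f n x \<in> X" if "n \<ge> N" "x \<in> X" for n x
    using surjective[of n] that by (auto simp: N_def)
  have "d (f n x) (f n y) < \<epsilon>" if n: "n \<ge> N" and xy: "x \<in> X" "y \<in> X" "d x y < \<delta>" for n x y
  proof -
    have close: "d (f n z) (f N z) < 2 * \<epsilon> / 5" if z: "z \<in> X" for z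
      using triangle[of "f n z" "h z" "f N z"] N[OF n z] N[OF order_refl z] f h n z
      by (simp add: commute)
    have "d (f n x) (f n y) \<le> d (f n x) (f N x) + (d (f N x) (f N y) + d (f N y) (f n y))"
      using triangle[of "f n x" "f N x" "f n y"] triangle[of "f N x" "f N y" "f n y"] f n xy
      by simp
    also have "\<dots> < \<epsilon>"
      using close[of x] close[of y] \<delta>[of x y] xy by (simp add: commute)
    finally show ?thesis .
  qed
  with \<open>\<delta> > 0\<close> show thesis
    by (rule that)
qed

text \<open>Induction on the block length, peeling off the first map of the block: tail
  equicontinuity gives \<open>\<delta>1\<close>-closeness at time \<open>Suc n\<close>, where the
  induction hypothesis takes over.\<close>

lemma uniform_limit_imp_iter_equicontinuous:
  assumes lim: "converges_uniformly_on X d f h" and "\<epsilon> > 0"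
  shows "\<exists>\<delta>>0. \<exists>N. \<forall>n\<ge>N. \<forall>k\<le>M. \<forall>x\<in>X. \<forall>y\<in>X.
    d (iter f n x) (iter f n y) < \<delta> \<longrightarrow> d (iter f (n + k) x) (iter f (n + k) y) < \<epsilon>"
proof (induction M)
  case 0
  then show ?case
    using \<open>\<epsilon> > 0\<close> by auto
next
  case (Suc M)
  then obtain \<delta>1 N1 where "\<delta>1 > 0" and IH: "\<And>n k x y.
      \<lbrakk>n \<ge> N1; k \<le> M; x \<in> X; y \<in> X; d (iter f n x) (iter f n y) < \<delta>1\<rbrakk>
      \<Longrightarrow> d (iter f (n + k) x) (iter f (n + k) y) < \<epsilon>"
    by blast
  obtain \<delta>2 N2 where "\<delta>2 > 0" and step:
    "\<And>n x y. \<lbrakk>n \<ge> N2; x \<in> X; y \<in> X; d x y < \<delta>2\<rbrakk> \<Longrightarrow> d (f n x) (f n y) < \<delta>1"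
    using uniform_limit_imp_tail_equicontinuous[OF lim \<open>\<delta>1 > 0\<close>] by blast
  \<comment> \<open>In the minimum, \<open>\<epsilon>\<close> settles \<open>k = 0\<close> and
    \<open>\<delta>2\<close> controls the first map.\<close>
  have "d (iter f (n + k) x) (iter f (n + k) y) < \<epsilon>"
    if n: "n \<ge> max N1 N2" and k: "k \<le> Suc M" and xy: "x \<in> X" "y \<in> X"
      and close: "d (iter f n x) (iter f n y) < min \<epsilon> \<delta>2" for n k x y
  proof (cases k)
    case 0
    then show ?thesis using close by simp
  next
    case (Suc j)
    have "d (iter f (Suc n) x) (iter f (Suc n) y) < \<delta>1"
      using step[of "Suc n"] n xy close iter_in_space by simp
    then have "d (iter f (Suc n + j) x) (iter f (Suc n + j) y) < \<epsilon>"
      using IH[of "Suc n" j] n k xy Suc by simp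
    then show ?thesis
      using Suc by simp
  qed
  moreover have "min \<epsilon> \<delta>2 > 0"
    using \<open>\<epsilon> > 0\<close> \<open>\<delta>2 > 0\<close> by simp
  ultimately show ?case
    by blast
qed

end

theorem theorem4p2:
  fixes X :: "'a set" and dX :: "'a \<Rightarrow> 'a \<Rightarrow> real" and f :: "nat \<Rightarrow> 'a \<Rightarrow> 'a"
    and Y :: "'b set" and dY :: "'b \<Rightarrow> 'b \<Rightarrow> real" and g :: "nat \<Rightarrow> 'b \<Rightarrow> 'b"
    and g_lim :: "'b \<Rightarrow> 'b"
  assumes "nonautonomous_system X dX f"
    and "nonautonomous_system Y dY g"
    and "converges_uniformly_on Y dY g g_lim"
  shows "\<forall>x1\<in>X. \<forall>x2\<in>X. \<forall>y1\<in>Y. \<forall>y2\<in>Y.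
    ((x1, x2), (y1, y2)) \<in> syndetically_proximal_pairs X dX f \<times> proximal_pairs Y dY g \<longrightarrow>
    ((x1, y1), (x2, y2)) \<in> proximal_pairs (X \<times> Y) (max_dist dX dY) (prod_maps f g)"
proof (intro ballI impI)
  interpret F: nonautonomous_system X dX f by fact
  interpret G: nonautonomous_system Y dY g by fact
  interpret FG: Metric_space "X \<times> Y" "max_dist dX dY"
    by (intro Metric_space_max_dist F.Metric_space_axioms G.Metric_space_axioms)
  fix x1 x2 y1 y2
  assume mem: "x1 \<in> X" "x2 \<in> X" "y1 \<in> Y" "y2 \<in> Y"
    and "((x1, x2), (y1, y2)) \<in> syndetically_proximal_pairs X dX f \<times> proximal_pairs Y dY g"
  then have syn: "\<And>\<epsilon>. \<epsilon> > 0 \<Longrightarrow> syndetic {n. n \<ge> 1 \<and> dX (iter f n x1) (iter f n x2) < \<epsilon>}"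
    and prox: "\<And>\<delta> N. \<delta> > 0 \<Longrightarrow> \<exists>n\<ge>N. dY (iter g n y1) (iter g n y2) < \<delta>"
    by (auto simp: syndetically_proximal_pairs_def proximal_pairs_def liminf_ereal_eq_0_iff)
  have "\<exists>n\<ge>N. max_dist dX dY (iter (prod_maps f g) n (x1, y1)) (iter (prod_maps f g) n (x2, y2)) < \<epsilon>"
    if eps: "\<epsilon> > 0" for \<epsilon> N
  proof -
    obtain M N1 where hit: "\<And>n. n \<ge> N1 \<Longrightarrow> \<exists>k\<le>M. dX (iter f (n + k) x1) (iter f (n + k) x2) < \<epsilon>"
      using syndetic_bounded_gaps[OF syn[OF eps]] by (metis (no_types, lifting) mem_Collect_eq)
    \<comment> \<open>The order of choices matters: \<open>\<delta>\<close> depends on the window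
      length \<open>M\<close>, which \<open>\<epsilon>\<close> has already fixed.\<close>
    obtain \<delta> N2 where "\<delta> > 0" and stay: "\<And>n k.
        \<lbrakk>n \<ge> N2; k \<le> M; dY (iter g n y1) (iter g n y2) < \<delta>\<rbrakk>
        \<Longrightarrow> dY (iter g (n + k) y1) (iter g (n + k) y2) < \<epsilon>"
      using G.uniform_limit_imp_iter_equicontinuous[OF assms(3) eps, of M] mem by blast
    \<comment> \<open>Proximality provides a time beyond all three thresholds; the common close time
      \<open>n + k\<close> is then still at least \<open>N\<close>.\<close>
    obtain n where n: "n \<ge> max N (max N1 N2)" "dY (iter g n y1) (iter g n y2) < \<delta>"
      using prox[OF \<open>\<delta> > 0\<close>] by blast
    moreover obtain k where "k \<le> M" "dX (iter f (n + k) x1) (iter f (n + k) x2) < \<epsilon>"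
      using hit[of n] n by auto
    ultimately show ?thesis
      using stay[of n k] by (intro exI[of _ "n + k"]) (simp add: iter_prod_maps max_dist_def)
  qed
  then show "((x1, y1), (x2, y2)) \<in> proximal_pairs (X \<times> Y) (max_dist dX dY) (prod_maps f g)"
    using mem by (simp add: proximal_pairs_def liminf_ereal_eq_0_iff)
qed

end
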